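(* Let $n\ge 1$, let $A\subseteq\{1,\dots,n\}$ be nonempty, and let $\mathbf p$ be any position of $SN(n,A)$ with $o$ stacks of odd height. (1) If $o=0$, then $\mathbf p$ is a P-position. (2) If $o\in A$, then $\mathbf p$ is an N-position.
   Context: The game $SN(n,A)$ is played on $n$ stacks of tokens; a position is $\mathbf p=(p_1,\dots,p_n)$ of nonnegative integers. A move consists of choosing some $\ell\in A$ and $\ell$ distinct stacks, each of height at least $1$, and removing exactly one token from each. Players alternate; a player unable to move loses (normal play). A P-position is one from which the player to move loses under optimal play; an N-position is one from which the player to move wins. *)

theory Defs
  imports Main
begin

text \<open>Outcome classes of a normal-play game with move relation \<open>move\<close>. Both predicates are least
  fixed points, so \<open>N_position\<close> says that the player to move can force a win, and \<open>P_position\<close>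
  that the opponent can, in each case after finitely many moves. A position without moves is a
  P-position, the premise of the first rule being vacuous there.\<close>

inductive P_position :: "('p \<Rightarrow> 'p \<Rightarrow> bool) \<Rightarrow> 'p \<Rightarrow> bool"
  and N_position :: "('p \<Rightarrow> 'p \<Rightarrow> bool) \<Rightarrow> 'p \<Rightarrow> bool"
  for move :: "'p \<Rightarrow> 'p \<Rightarrow> bool"
where
  P_positionI: "(\<And>q. move p q \<Longrightarrow> N_position move q) \<Longrightarrow> P_position move p"
| N_positionI: "move p q \<Longrightarrow> P_position move q \<Longrightarrow> N_position move p"

definition SN_position :: "nat \<Rightarrow> nat list \<Rightarrow> bool" where
  "SN_position n p \<longleftrightarrow> length p = n"

text \<open>Stacks are numbered from 0; \<open>S\<close> is the set of the chosen stacks.\<close>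

definition SN_move :: "nat \<Rightarrow> nat set \<Rightarrow> nat list \<Rightarrow> nat list \<Rightarrow> bool" where
  "SN_move n A p q \<longleftrightarrow> SN_position n p \<and> SN_position n q \<and>
     (\<exists>S \<subseteq> {..<n}. card S \<in> A \<and> (\<forall>i\<in>S. 1 \<le> p ! i) \<and>
        (\<forall>i<n. q ! i = (if i \<in> S then p ! i - 1 else p ! i)))"

definition odd_stacks :: "nat list \<Rightarrow> nat" where
  "odd_stacks p = card {i. i < length p \<and> odd (p ! i)}"

text \<open>Sanity checks: in every game no position is in both classes, and if \<open>0 \<notin> A\<close> then every
  position is in exactly one.\<close>

lemma not_P_and_N: "\<not> (P_position move p \<and> N_position move p)"
proof -
  have "P_position move x \<Longrightarrow> \<not> N_position move x"
    and "N_position move y \<Longrightarrow> \<not> P_position move y" for x y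
  proof (induction rule: P_position_N_position.inducts)
    case (P_positionI p)
    then show ?case by (meson N_position.cases)
  next
    case (N_positionI p q)
    then show ?case by (meson P_position.cases)
  qed
  then show ?thesis by blast
qed

lemma SN_move_sum_list:
  assumes "0 \<notin> A" and "SN_move n A p q"
  shows "sum_list q < sum_list p"
proof -
  obtain S where S: "S \<subseteq> {..<n}" "card S \<in> A" "\<forall>i\<in>S. 1 \<le> p ! i"
    and q: "\<forall>i<n. q ! i = (if i \<in> S then p ! i - 1 else p ! i)"
    and len: "length p = n" "length q = n"
    using assms(2) by (auto simp: SN_move_def SN_position_def)
  have "S \<noteq> {}" using S(2) assms(1) by auto
  then obtain i where i: "i \<in> S" by blast
  have "i < n" using i S(1) by blast
  have "q ! i < p ! i" using q S(3) i \<open>i < n\<close> by force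
  then have "(\<Sum>j = 0..<n. q ! j) < (\<Sum>j = 0..<n. p ! j)"
    using q \<open>i < n\<close> \<open>q ! i < p ! i\<close> by (intro sum_strict_mono_ex1 bexI[of _ i]) (simp_all del: One_nat_def)
  then show ?thesis using len by (simp add: sum_list_sum_nth)
qed

lemma SN_determined:
  assumes "0 \<notin> A"
  shows "P_position (SN_move n A) p \<longleftrightarrow> \<not> N_position (SN_move n A) p"
proof -
  have "P_position (SN_move n A) p \<or> N_position (SN_move n A) p"
  proof (induction p rule: measure_induct_rule[where f = sum_list])
    case (less p)
    then show ?case
      using SN_move_sum_list[OF assms] P_positionI N_positionI by metis
  qed
  then show ?thesis using not_P_and_N[of "SN_move n A" p] by blast
qed

end

theory Submission
  imports Defs
begin

text \<open>A move from a position with only even stacks makes exactly the \<open>\<ell> \<in> A\<close> chosen stacks odd,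
  and the opponent may answer by playing on those same stacks, which are nonempty because they are
  odd; this restores evenness. So the player facing even stacks runs out of moves first.\<close>

lemma odd_stacks_move_from_even:
  assumes "SN_move n A p q" and "odd_stacks p = 0"
  shows "odd_stacks q \<in> A"
proof -
  obtain S where S: "S \<subseteq> {..<n}" "card S \<in> A" "\<forall>i\<in>S. 1 \<le> p ! i"
    and q: "\<forall>i<n. q ! i = (if i \<in> S then p ! i - 1 else p ! i)"
    and len: "length p = n" "length q = n"
    using assms(1) by (auto simp: SN_move_def SN_position_def)
  have "\<forall>i<n. even (p ! i)"
    using assms(2) len by (auto simp: odd_stacks_def)
  \<comment> \<open>\<open>S(3)\<close> rules out height 0, where truncated subtraction would give
    \<open>0 - 1 = 0\<close> and leave the parity unchanged.\<close>
  then have "odd (q ! i) \<longleftrightarrow> i \<in> S" if "i < n" for i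
    using that S(3) q by (cases "i \<in> S") auto
  then have "{i. i < length q \<and> odd (q ! i)} = S"
    using S(1) len by auto
  then show ?thesis using S(2) by (simp add: odd_stacks_def)
qed

text \<open>Playing on all odd stacks at once is legal: their number lies in \<open>A\<close>, and
  odd heights are at least 1. Every height is then even.\<close>

lemma SN_move_to_even:
  assumes "SN_position n p" and "odd_stacks p \<in> A"
  obtains q where "SN_move n A p q" and "odd_stacks q = 0"
proof
  let ?S = "{i. i < length p \<and> odd (p ! i)}"
  let ?q = "map (\<lambda>x. if odd x then x - 1 else x) p"
  have "?S \<subseteq> {..<n}" "card ?S \<in> A" "\<forall>i\<in>?S. 1 \<le> p ! i"
    "\<forall>i<n. ?q ! i = (if i \<in> ?S then p ! i - 1 else p ! i)"
    using assms by (auto simp: SN_position_def odd_stacks_def intro: Suc_leI odd_pos)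
  then show "SN_move n A p ?q"
    unfolding SN_move_def using assms(1) by (auto simp: SN_position_def simp del: One_nat_def)
  show "odd_stacks ?q = 0"
    by (auto simp: odd_stacks_def)
qed

theorem theorem5:
  fixes n :: nat and A :: "nat set" and p :: "nat list"
  assumes "1 \<le> n" and "A \<subseteq> {1..n}" and "A \<noteq> {}" and "SN_position n p"
  shows "(odd_stacks p = 0 \<longrightarrow> P_position (SN_move n A) p) \<and>
    (odd_stacks p \<in> A \<longrightarrow> N_position (SN_move n A) p)"
  using assms(4)
\<comment> \<open>Both claims share one induction on the number of tokens, since each claim at
  \<open>p\<close> relies on the other at positions one move away.\<close>
proof (induction p rule: measure_induct_rule[where f = sum_list])
  case (less p)
  \<comment> \<open>This excludes a move on no stacks, which would leave the token count
    unchanged.\<close>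
  have "0 \<notin> A" using assms(2) by auto
  note smaller = SN_move_sum_list[OF this]
  show ?case
  proof (intro conjI impI)
    assume "odd_stacks p = 0"
    then have "N_position (SN_move n A) q" if "SN_move n A p q" for q
      using that less.IH smaller odd_stacks_move_from_even by (metis SN_move_def)
    then show "P_position (SN_move n A) p" by (rule P_positionI)
  next
    assume "odd_stacks p \<in> A"
    then obtain q where "SN_move n A p q" "odd_stacks q = 0"
      using SN_move_to_even less.prems by blast
    then show "N_position (SN_move n A) p"
      using less.IH smaller by (metis SN_move_def N_positionI)
  qed
qed

end
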